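(* For complex $\beta,m,x,z$, $$\sum_{n=0}^{\infty}\frac{\Gamma(m\beta+n\beta+1)\,\bigl(x(x+1)^{-\beta}e^{-xz}\bigr)^n\;{}_1F_1\bigl(-n;\,n(\beta-1)+m\beta+1;\,(-m-n)z\bigr)}{\Gamma(n+1)\,\Gamma(\beta n-n+m\beta+1)}=-\frac{(x+1)\bigl((x+1)^{\beta}e^{xz}\bigr)^m}{x(\beta+xz+z-1)-1}.$$
   Context: $\Gamma$ is the Euler gamma function and ${}_1F_1(a;b;z)=\sum_{k\ge0}\frac{(a)_k}{(b)_k\,k!}z^k$ is the Kummer confluent hypergeometric function, with $(a)_k=a(a+1)\cdots(a+k-1)$.
   Formalization: Fails for arbitrary x (β=2, m=z=0, x=3: sum 2, right side −2); proved for small |x| and on any connected open set around 0 where the series converges and principal powers are holomorphic. Coefficients with lower parameter in {0,−1,…} are read as limits in (β,m). *)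

theory Defs
  imports "HOL-Analysis.Analysis"
begin

definition kummer_1F1 :: "complex \<Rightarrow> complex \<Rightarrow> complex \<Rightarrow> complex" where
  "kummer_1F1 a b z = (\<Sum>k. pochhammer a k / (pochhammer b k * fact k) * z ^ k)"

definition kummer_coeff_raw :: "complex \<Rightarrow> complex \<Rightarrow> complex \<Rightarrow> nat \<Rightarrow> complex" where
  "kummer_coeff_raw \<beta> m z n =
     Gamma (m * \<beta> + of_nat n * \<beta> + 1)
       * kummer_1F1 (- of_nat n) (of_nat n * (\<beta> - 1) + m * \<beta> + 1) ((- m - of_nat n) * z)
     / (Gamma (of_nat n + 1) * Gamma (\<beta> * of_nat n - of_nat n + m * \<beta> + 1))"

(* The parameters for which the raw expression is literally meaningful. If the lower parameter
   b = n(\<beta> - 1) + m\<beta> + 1 is not in {0, -1, -2, ...}, then 1F1 is defined, and neither Gamma(b)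
   nor Gamma(b + n), the two parameter-dependent Gamma factors, is at a pole. *)
definition kummer_regular :: "nat \<Rightarrow> (complex \<times> complex) set" where
  "kummer_regular n = {(\<beta>, m). of_nat n * (\<beta> - 1) + m * \<beta> + 1 \<notin> \<int>\<^sub>\<le>\<^sub>0}"

(* For (\<beta>, m) outside kummer_regular n the raw expression has the indeterminate form
   "infinity times 1 / infinity", with a removable singularity in (\<beta>, m); the intended value is the
   limit. The total functions of HOL (Gamma = 0 at its poles, x / 0 = 0) would give another
   value there, e.g. for \<beta> = 0. *)
definition kummer_coeff :: "complex \<Rightarrow> complex \<Rightarrow> complex \<Rightarrow> nat \<Rightarrow> complex" where
  "kummer_coeff \<beta> m z n =
     (if (\<beta>, m) \<in> kummer_regular n then kummer_coeff_raw \<beta> m z n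
      else Lim (at (\<beta>, m) within kummer_regular n) (\<lambda>(\<beta>', m'). kummer_coeff_raw \<beta>' m' z n))"

definition kummer_term :: "complex \<Rightarrow> complex \<Rightarrow> complex \<Rightarrow> complex \<Rightarrow> nat \<Rightarrow> complex" where
  "kummer_term \<beta> m x z n =
     kummer_coeff \<beta> m z n * (x * (x + 1) powr (- \<beta>) * exp (- (x * z))) ^ n"

definition kummer_sum_value :: "complex \<Rightarrow> complex \<Rightarrow> complex \<Rightarrow> complex \<Rightarrow> complex" where
  "kummer_sum_value \<beta> m x z =
     - ((x + 1) * ((x + 1) powr \<beta> * exp (x * z)) powr m / (x * (\<beta> + x * z + z - 1) - 1))"

(* Where the principal branches of all the complex powers in the identity are holomorphic in x. *)
definition principal_domain :: "complex \<Rightarrow> complex \<Rightarrow> complex set" where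
  "principal_domain \<beta> z =
     {x. x + 1 \<notin> \<real>\<^sub>\<le>\<^sub>0 \<and> (x + 1) powr \<beta> * exp (x * z) \<notin> \<real>\<^sub>\<le>\<^sub>0}"

end

(* Since (b + k)_(n - k) / (n - k)! = binomial((m + n) \<beta>, n - k) for b = n (\<beta> - 1) + m \<beta> + 1, the n-th
   coefficient of the series is [w^n] \<phi>(w)^(m + n) with \<phi>(w) = (1 + w)^\<beta> exp(w z). With t = x / \<phi>(x),
   the Lagrange-Buermann formula gives
     sum over n of t^n [w^n] \<phi>(w)^m \<phi>(w)^n = \<phi>(x)^m / (1 - t \<phi>'(x))
   for small x. On a larger domain U, the open mapping theorem turns pointwise convergence of the
   series into t(U) lying in the open disc of convergence, so the identity theorem applies to the
   equation multiplied by the denominator; the numerator has no zero, hence neither has the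
   denominator. *)

theory Submission
  imports Defs "HOL-Complex_Analysis.Complex_Analysis"
begin

section \<open>The Lagrange-Buermann formula as a convergent series\<close>

text \<open>By Cauchy's formula the n-th term is, up to the factor 2 pi i, the integral of
  \<open>h w / w * (t * \<phi> w / w) ^ n\<close> over the circle of radius \<rho>. There the ratio
  has norm at most c < 1, so the geometric series can be summed under the integral. The resulting
  integrand \<open>h w / (w - t * \<phi> w)\<close> has x as its only possible pole inside, and the
  value at x comes from Cauchy's integral formula.\<close>

lemma Lagrange_inversion_sums_at:
  fixes \<phi> h :: "complex \<Rightarrow> complex"
  assumes hol: "\<phi> holomorphic_on ball 0 R" "h holomorphic_on ball 0 R"
    and \<rho>: "0 < \<rho>" "\<rho> < R"
    and x: "norm x < \<rho>" "x = t * \<phi> x"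
    and c: "c < 1"
    and bound: "\<And>w. norm w = \<rho> \<Longrightarrow> norm (t * \<phi> w) \<le> c * \<rho>"
    and bound': "\<And>w. norm w \<le> \<rho> \<Longrightarrow> norm (t * deriv \<phi> w) \<le> c"
  shows "(\<lambda>n. (deriv ^^ n) (\<lambda>w. h w * \<phi> w ^ n) 0 / fact n * t ^ n)
           sums (h x / (1 - t * deriv \<phi> x))"
proof -
  define \<gamma> where "\<gamma> = circlepath (0::complex) \<rho>"
  define a where "a = (\<lambda>n. (deriv ^^ n) (\<lambda>w. h w * \<phi> w ^ n) 0 / fact n * t ^ n)"
  define f where "f = (\<lambda>n w. h w / w * (t * \<phi> w / w) ^ n)"
  define l where "l = (\<lambda>w. h w / (w - t * \<phi> w))"
  define g where "g = (\<lambda>w. if w = x then deriv \<phi> x else (\<phi> w - \<phi> x) / (w - x))"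
  have sub: "cball 0 \<rho> \<subseteq> ball (0::complex) R" "sphere 0 \<rho> \<subseteq> ball (0::complex) R"
    using \<rho> by auto
  have holc: "\<phi> holomorphic_on cball 0 \<rho>" "h holomorphic_on cball 0 \<rho>"
    using hol sub holomorphic_on_subset by blast+
  have cint: "(f n has_contour_integral (2 * pi * \<i> * a n)) \<gamma>" for n
  proof -
    have "(\<lambda>w. h w * \<phi> w ^ n) holomorphic_on cball 0 \<rho>"
      by (intro holomorphic_intros holc)
    hence "((\<lambda>w. h w * \<phi> w ^ n / (w - 0) ^ Suc n) has_contour_integral
            (2 * pi * \<i> / fact n * (deriv ^^ n) (\<lambda>w. h w * \<phi> w ^ n) 0)) \<gamma>"
      unfolding \<gamma>_def using \<rho>
      by (intro Cauchy_has_contour_integral_higher_derivative_circlepath)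
         (auto intro: holomorphic_on_imp_continuous_on holomorphic_on_subset)
    from has_contour_integral_lmul[OF this, of "t ^ n"]
    show ?thesis
      by (simp add: f_def a_def power_mult_distrib power_divide mult_ac)
  qed
  \<comment> \<open>\<open>t \<phi>\<close> is a contraction, so \<open>w - t \<phi> w = (w - x) (1 - t g w)\<close> vanishes only at \<open>x\<close>;
    this replaces the usual appeal to Rouche's theorem.\<close>
  have gne: "norm (t * g w) \<le> c" if "w \<in> cball 0 \<rho>" for w
  proof (cases "w = x")
    case True
    thus ?thesis using bound' that by (auto simp: g_def)
  next
    case False
    have "norm (t * \<phi> w - t * \<phi> x) \<le> c * norm (w - x)"
    proof (rule field_differentiable_bound[where S = "cball 0 \<rho>" and f' = "\<lambda>w. t * deriv \<phi> w"])
      fix u :: complex assume u: "u \<in> cball 0 \<rho>"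
      hence "(\<phi> has_field_derivative deriv \<phi> u) (at u within cball 0 \<rho>)"
        using hol sub by (meson holomorphic_derivI open_ball subsetD)
      thus "((\<lambda>w. t * \<phi> w) has_field_derivative t * deriv \<phi> u) (at u within cball 0 \<rho>)"
        by (auto intro!: derivative_eq_intros)
    qed (use that x bound' in auto)
    thus ?thesis using False
      by (simp add: g_def norm_mult norm_divide divide_simps flip: right_diff_distrib)
  qed
  hence gne': "t * g w \<noteq> 1" if "norm w \<le> \<rho>" for w
    using that c by (metis mem_cball_0 norm_one not_le)
  have l_eq: "l w = h w / (1 - t * g w) / (w - x)" if "w \<noteq> x" for w
  proof -
    have "w - t * \<phi> w = (w - x) - t * (\<phi> w - \<phi> x)"
      using x by (simp add: algebra_simps)
    also have "\<dots> = (1 - t * g w) * (w - x)"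
      using that by (simp add: g_def field_simps)
    finally show ?thesis by (simp add: l_def)
  qed
  \<comment> \<open>The singularity of the difference quotient \<open>g\<close> at x is removable.
    Hence \<open>l\<close> is a holomorphic function divided by w - x, and Cauchy's integral formula
    takes the place of a residue computation; \<open>g x = deriv \<phi> x\<close> produces the
    denominator.\<close>
  have "g holomorphic_on ball 0 R"
    unfolding g_def by (rule pole_lemma_open) (use hol in auto)
  hence "(\<lambda>w. h w / (1 - t * g w)) holomorphic_on cball 0 \<rho>"
    using gne' sub by (intro holomorphic_intros holc) (auto intro: holomorphic_on_subset)
  from Cauchy_integral_circlepath_simple[OF this, of x]
  have "((\<lambda>w. h w / (1 - t * g w) / (w - x)) has_contour_integral
           (2 * pi * \<i> * (h x / (1 - t * g x)))) \<gamma>"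
    unfolding \<gamma>_def using x by simp
  hence "(l has_contour_integral (2 * pi * \<i> * (h x / (1 - t * g x)))) \<gamma>"
  proof (rule has_contour_integral_eq)
    fix w assume "w \<in> path_image \<gamma>"
    hence "w \<noteq> x" using x \<rho> by (auto simp: \<gamma>_def)
    thus "h w / (1 - t * g w) / (w - x) = l w" by (rule l_eq[symmetric])
  qed
  hence l_int: "(l has_contour_integral (2 * pi * \<i> * (h x / (1 - t * deriv \<phi> x)))) \<gamma>"
    by (simp add: g_def)
  \<comment> \<open>The majorant \<open>B / \<rho> * c ^ n\<close> makes the convergence uniform on
    the circle, which justifies exchanging sum and integral.\<close>
  have lim: "uniform_limit (sphere 0 \<rho>) (\<lambda>n w. \<Sum>i<n. f i w) l sequentially"
  proof -
    have "bounded (h ` sphere 0 \<rho>)"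
      by (intro compact_imp_bounded compact_continuous_image holomorphic_on_imp_continuous_on
            holomorphic_on_subset[OF hol(2)] sub) auto
    then obtain B where B: "\<And>w. w \<in> sphere 0 \<rho> \<Longrightarrow> norm (h w) \<le> B"
      unfolding bounded_iff by blast
    have q: "norm (t * \<phi> w / w) \<le> c" if "w \<in> sphere 0 \<rho>" for w
      using bound[of w] that \<rho> by (simp add: norm_divide divide_simps)
    \<comment> \<open>The point \<rho> of the circle witnesses that c bounds some norm, hence is
      nonnegative.\<close>
    have c0: "0 \<le> c"
      using q[of "of_real \<rho>"] \<rho> by (smt (verit) mem_sphere_0 norm_ge_zero norm_of_real)
    have "uniform_limit (sphere 0 \<rho>) (\<lambda>n w. \<Sum>i<n. f i w) (\<lambda>w. suminf (\<lambda>i. f i w)) sequentially"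
    proof (rule Weierstrass_m_test)
      fix n w assume w: "w \<in> sphere (0::complex) \<rho>"
      have "norm (f n w) = norm (h w) / \<rho> * norm (t * \<phi> w / w) ^ n"
        using w by (simp add: f_def norm_mult norm_divide norm_power)
      also have "\<dots> \<le> B / \<rho> * c ^ n"
        using B[OF w] q[OF w] \<rho> order_trans[OF norm_ge_zero B[OF w]]
        by (intro mult_mono divide_right_mono power_mono) auto
      finally show "norm (f n w) \<le> B / \<rho> * c ^ n" .
    next
      show "summable (\<lambda>n. B / \<rho> * c ^ n)"
        using c c0 by (intro summable_mult summable_geometric) auto
    qed
    moreover have "(\<Sum>i. f i w) = l w" if w: "w \<in> sphere 0 \<rho>" for w
    proof -
      have "(\<lambda>i. f i w) sums (h w / w * (1 / (1 - t * \<phi> w / w)))"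
        unfolding f_def using q[OF w] c by (intro sums_mult geometric_sums) auto
      moreover have "h w / w * (1 / (1 - t * \<phi> w / w)) = l w"
      proof -
        have "w \<noteq> 0" using w \<rho> by auto
        hence "w - t * \<phi> w = w * (1 - t * \<phi> w / w)" by (simp add: field_simps)
        thus ?thesis by (simp add: l_def)
      qed
      ultimately show ?thesis by (simp add: sums_iff)
    qed
    ultimately show ?thesis
      by (metis (no_types, lifting) uniform_limit_cong'[OF refl])
  qed
  have sumint: "((\<lambda>w. \<Sum>i<n. f i w) has_contour_integral (\<Sum>i<n. 2 * pi * \<i> * a i)) \<gamma>" for n
    by (intro has_contour_integral_sum cint) auto
  have "(\<lambda>n. contour_integral \<gamma> (\<lambda>w. \<Sum>i<n. f i w)) \<longlonglongrightarrow> contour_integral \<gamma> l"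
    unfolding \<gamma>_def
  proof (rule contour_integral_uniform_limit_circlepath)
    show "\<forall>\<^sub>F n in sequentially. (\<lambda>w. \<Sum>i<n. f i w) contour_integrable_on circlepath 0 \<rho>"
      using sumint unfolding \<gamma>_def by (intro always_eventually allI has_contour_integral_integrable)
  qed (use lim \<rho> in auto)
  hence "(\<lambda>n. \<Sum>i<n. 2 * pi * \<i> * a i) \<longlonglongrightarrow> 2 * pi * \<i> * (h x / (1 - t * deriv \<phi> x))"
    using contour_integral_unique[OF sumint] contour_integral_unique[OF l_int] by simp
  hence "(\<lambda>i. 2 * pi * \<i> * a i) sums (2 * pi * \<i> * (h x / (1 - t * deriv \<phi> x)))"
    by (simp add: sums_def)
  from sums_mult[OF this, of "1 / (2 * pi * \<i>)"] show ?thesis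
    by (simp add: a_def)
qed

text \<open>Since \<phi> 0 is nonzero, t = x / \<phi> x tends to 0 with x, while \<phi> and its
  derivative are bounded on a fixed compact disc. For small x the contraction bounds therefore hold
  with c = 1/2.\<close>

lemma Lagrange_inversion_sums:
  fixes \<phi> h :: "complex \<Rightarrow> complex"
  assumes "0 < R" and hol: "\<phi> holomorphic_on ball 0 R" "h holomorphic_on ball 0 R" and "\<phi> 0 \<noteq> 0"
  shows "eventually (\<lambda>x. (\<lambda>n. (deriv ^^ n) (\<lambda>w. h w * \<phi> w ^ n) 0 / fact n * (x / \<phi> x) ^ n)
           sums (h x / (1 - x / \<phi> x * deriv \<phi> x))) (nhds 0)"
proof -
  define \<rho> where "\<rho> = R / 2"
  have \<rho>: "0 < \<rho>" "\<rho> < R" using \<open>0 < R\<close> by (auto simp: \<rho>_def)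
  have bdd: "\<exists>B>0. \<forall>w. norm w \<le> \<rho> \<longrightarrow> norm (f w) \<le> B" if "f holomorphic_on ball 0 R"
    for f :: "complex \<Rightarrow> complex"
  proof -
    have "bounded (f ` cball 0 \<rho>)"
      using \<rho> by (intro compact_imp_bounded compact_continuous_image holomorphic_on_imp_continuous_on
            holomorphic_on_subset[OF that]) auto
    thus ?thesis by (fastforce simp: bounded_pos)
  qed
  obtain B where B: "B > 0" "\<And>w. norm w \<le> \<rho> \<Longrightarrow> norm (\<phi> w) \<le> B"
    using bdd[OF hol(1)] by blast
  obtain K where K: "K > 0" "\<And>w. norm w \<le> \<rho> \<Longrightarrow> norm (deriv \<phi> w) \<le> K"
    using bdd[OF holomorphic_deriv[OF hol(1)]] by auto
  \<comment> \<open>The first entry makes \<open>t * \<phi>\<close> at most \<rho>/2 on the circle,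
    the second makes \<open>t * deriv \<phi>\<close> at most 1/2 on the disc, whenever t has norm
    below \<delta>.\<close>
  define \<delta> where "\<delta> = min (\<rho> / (2 * B)) (1 / (2 * K))"
  have \<delta>: "\<delta> > 0" "\<delta> * B \<le> 1 / 2 * \<rho>" "\<delta> * K \<le> 1 / 2"
    using \<rho> B(1) K(1) by (auto simp: \<delta>_def min_def field_simps)
  have "isCont \<phi> 0"
    using hol(1) \<open>0 < R\<close> by (meson centre_in_ball continuous_on_interior holomorphic_on_imp_continuous_on
        interior_open open_ball continuous_on_eq_continuous_at)
  hence \<phi>: "(\<phi> \<longlongrightarrow> \<phi> 0) (nhds 0)" by (simp add: continuous_at tendsto_at_iff_tendsto_nhds isCont_def)
  hence "((\<lambda>x. x / \<phi> x) \<longlongrightarrow> 0 / \<phi> 0) (nhds 0)"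
    by (intro tendsto_intros filterlim_ident) (use assms in auto)
  hence "eventually (\<lambda>x. dist (x / \<phi> x) (0 / \<phi> 0) < \<delta>) (nhds 0)"
    using \<delta>(1) by (rule tendstoD)
  moreover have "eventually (\<lambda>x. \<phi> x \<noteq> 0) (nhds 0)"
    using \<phi> \<open>\<phi> 0 \<noteq> 0\<close> by (rule tendsto_imp_eventually_ne)
  moreover have "eventually (\<lambda>x::complex. x \<in> ball 0 \<rho>) (nhds 0)"
    using \<rho> by (intro eventually_nhds_in_open) auto
  ultimately show ?thesis
  proof eventually_elim
    case (elim x)
    have small: "norm (x / \<phi> x * u) \<le> \<delta> * C" if "norm u \<le> C" for u C
      using elim(1) that \<delta>(1) unfolding norm_mult by (intro mult_mono) (auto simp: order_trans)
    show ?case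
    proof (rule Lagrange_inversion_sums_at[OF hol \<rho>, where c = "1/2"])
      show "norm (x / \<phi> x * \<phi> w) \<le> 1 / 2 * \<rho>" if "norm w = \<rho>" for w
        using that by (intro order_trans[OF small[OF B(2)] \<delta>(2)]) simp
      show "norm (x / \<phi> x * deriv \<phi> w) \<le> 1 / 2" if "norm w \<le> \<rho>" for w
        using that by (intro order_trans[OF small[OF K(2)] \<delta>(3)])
    qed (use elim in auto)
  qed
qed

section \<open>Polynomial form of the coefficients\<close>

text \<open>This is the coefficient of w^n in (1 + w)^((m + n) \<beta>) exp((m + n) z w), written as
  a Cauchy product. It is a polynomial in \<beta> and m, so it is free of the Gamma poles of the raw
  expression.\<close>

definition kummer_poly :: "complex \<Rightarrow> complex \<Rightarrow> complex \<Rightarrow> nat \<Rightarrow> complex" where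
  "kummer_poly \<beta> m z n =
     (\<Sum>k\<le>n. ((m + of_nat n) * \<beta> gchoose (n - k)) * ((m + of_nat n) * z) ^ k / fact k)"

lemma pochhammer_minus_of_nat:
  assumes "k \<le> n"
  shows "pochhammer (- of_nat n :: 'a :: field_char_0) k = (- 1) ^ k * fact n / fact (n - k)"
proof -
  have "of_nat (n choose k) = (- 1) ^ k * pochhammer (- of_nat n :: 'a) k / fact k"
    by (simp only: binomial_gbinomial gbinomial_pochhammer)
  moreover have "(of_nat (n choose k) :: 'a) = fact n / (fact k * fact (n - k))"
    using assms by (rule binomial_fact)
  ultimately show ?thesis
    by (cases "even k") (auto simp: field_simps)
qed

text \<open>The Gamma quotient is (b)_n and the Kummer series stops at k = n because (-n)_k = 0
  beyond. Dividing (b)_n by (b)_k leaves (b + k)_(n - k), and the sign of (-n)_k cancels against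
  that of the k-th power of the argument.\<close>

lemma kummer_coeff_raw_eq_poly:
  assumes "(\<beta>, m) \<in> kummer_regular n"
  shows "kummer_coeff_raw \<beta> m z n = kummer_poly \<beta> m z n"
proof -
  define b where "b = of_nat n * (\<beta> - 1) + m * \<beta> + 1"
  have b: "b \<notin> \<int>\<^sub>\<le>\<^sub>0" using assms by (simp add: kummer_regular_def b_def)
  have poch_ne: "pochhammer b k \<noteq> 0" for k
    using b by (auto simp: pochhammer_eq_0_iff)
  have F: "kummer_1F1 (- of_nat n) b ((- m - of_nat n) * z) =
      (\<Sum>k\<le>n. pochhammer (- of_nat n) k / (pochhammer b k * fact k) * ((- m - of_nat n) * z) ^ k)"
    unfolding kummer_1F1_def by (intro suminf_finite) (auto simp: pochhammer_of_nat_eq_0_iff)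
  have Gamma_upper: "Gamma (m * \<beta> + of_nat n * \<beta> + 1) = pochhammer b n * Gamma b"
    using b Gamma_eq_zero_iff[of b] by (simp add: pochhammer_Gamma b_def algebra_simps)
  have Gamma_lower: "Gamma (\<beta> * of_nat n - of_nat n + m * \<beta> + 1) = Gamma b"
    by (simp add: b_def algebra_simps)
  have Gamma_fact': "Gamma (of_nat n + 1 :: complex) = fact n"
    by (metis Gamma_fact add.commute)
  have "kummer_coeff_raw \<beta> m z n =
      pochhammer b n / fact n * kummer_1F1 (- of_nat n) b ((- m - of_nat n) * z)"
    unfolding kummer_coeff_raw_def Gamma_upper Gamma_lower Gamma_fact' b_def[symmetric]
    using b by (simp add: Gamma_eq_zero_iff)
  also have "\<dots> = (\<Sum>k\<le>n. pochhammer b n / fact n *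
      (pochhammer (- of_nat n) k / (pochhammer b k * fact k) * ((- m - of_nat n) * z) ^ k))"
    unfolding F sum_distrib_left ..
  also have "\<dots> = kummer_poly \<beta> m z n"
    unfolding kummer_poly_def
  proof (rule sum.cong)
    fix k assume "k \<in> {..n}"
    hence k: "k \<le> n" by simp
    have "(m + of_nat n) * \<beta> gchoose (n - k) = pochhammer (b + of_nat k) (n - k) / fact (n - k)"
      using k by (simp add: gbinomial_pochhammer' b_def of_nat_diff algebra_simps)
    moreover have "pochhammer b n = pochhammer b k * pochhammer (b + of_nat k) (n - k)"
      using k by (rule pochhammer_product)
    moreover have "((- m - of_nat n) * z) ^ k = (- 1) ^ k * ((m + of_nat n) * z) ^ k"
      by (simp flip: power_mult_distrib add: algebra_simps)
    ultimately show "pochhammer b n / fact n *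
        (pochhammer (- of_nat n) k / (pochhammer b k * fact k) * ((- m - of_nat n) * z) ^ k) =
        ((m + of_nat n) * \<beta> gchoose (n - k)) * ((m + of_nat n) * z) ^ k / fact k"
      using poch_ne[of k] by (simp add: pochhammer_minus_of_nat[OF k] mult_ac add_ac flip: power_mult_distrib)
  qed simp
  finally show ?thesis .
qed

text \<open>This makes the limit in \<open>kummer_coeff\<close> meaningful: without it the filter
  would be trivial. At an irregular point b is an integer, so any nearby parameters that raise b by
  some s with 0 < s < 1 are regular.\<close>

lemma islimpt_kummer_regular:
  assumes "(\<beta>, m) \<notin> kummer_regular n"
  shows "(\<beta>, m) islimpt kummer_regular n"
proof -
  define b where "b = of_nat n * (\<beta> - 1) + m * \<beta> + 1"
  \<comment> \<open>The second \<open>Suc\<close> keeps \<open>e k\<close> strictly below 1 already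
    at k = 0, so the shift of b is never an integer.\<close>
  define e where "e = (\<lambda>k. inverse (real (Suc (Suc k))))"
  have e_pos: "0 < e k" "e k < 1" for k by (auto simp: e_def divide_simps)
  have e_lim: "e \<longlonglongrightarrow> 0"
    unfolding e_def by (rule LIMSEQ_Suc[OF LIMSEQ_inverse_real_of_nat])
  have b: "b \<in> \<int>"
    using assms by (auto simp: kummer_regular_def b_def nonpos_Ints_subset_Ints[THEN subsetD])
  have regularI: "(\<beta>', m') \<in> kummer_regular n"
    if "of_nat n * (\<beta>' - 1) + m' * \<beta>' + 1 = b + of_real s" "0 < s" "s < 1" for \<beta>' m' s
  proof -
    have "b + of_real s \<notin> \<int>"
    proof
      assume "b + of_real s \<in> \<int>"
      hence "b + of_real s - b \<in> \<int>" using b by (rule Ints_diff)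
      thus False using that(2,3) by (auto simp: complex_is_Int_iff elim!: Ints_cases)
    qed
    thus ?thesis using that(1) nonpos_Ints_subset_Ints by (auto simp: kummer_regular_def)
  qed
  have "\<exists>f. (\<forall>k. f k \<in> kummer_regular n) \<and> f \<longlonglongrightarrow> (\<beta>, m)"
  proof -
    \<comment> \<open>As b = (n + m) \<beta> - n + 1, its partial derivatives are \<beta> in m and n
      + m in \<beta>. One moves along whichever is nonzero; at the critical point both parameters
      move by \<open>e k\<close> and b changes by the square of it.\<close>
    consider "\<beta> \<noteq> 0" | "\<beta> = 0" "of_nat n + m \<noteq> 0" | "\<beta> = 0" "of_nat n + m = 0" by blast
    thus ?thesis
    proof cases
      case 1
      show ?thesis
      proof (intro exI[of _ "\<lambda>k. (\<beta>, m + of_real (e k) / \<beta>)"] conjI allI)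
        show "(\<beta>, m + of_real (e k) / \<beta>) \<in> kummer_regular n" for k
          using 1 by (intro regularI[OF _ e_pos]) (simp add: b_def field_simps)
        show "(\<lambda>k. (\<beta>, m + of_real (e k) / \<beta>)) \<longlonglongrightarrow> (\<beta>, m)"
          using 1 by (auto intro!: tendsto_eq_intros e_lim)
      qed
    next
      case 2
      show ?thesis
      proof (intro exI[of _ "\<lambda>k. (of_real (e k) / (of_nat n + m), m)"] conjI allI)
        show "(of_real (e k) / (of_nat n + m), m) \<in> kummer_regular n" for k
          using 2 by (intro regularI[OF _ e_pos]) (simp add: b_def divide_simps, simp add: algebra_simps)
        show "(\<lambda>k. (of_real (e k) / (of_nat n + m), m)) \<longlonglongrightarrow> (\<beta>, m)"
          using 2 by (auto intro!: tendsto_eq_intros e_lim)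
      qed
    next
      case 3
      hence m: "m = - of_nat n" by (simp add: eq_neg_iff_add_eq_0 add.commute)
      show ?thesis
      proof (intro exI[of _ "\<lambda>k. (of_real (e k), m + of_real (e k))"] conjI allI)
        show "(of_real (e k), m + of_real (e k)) \<in> kummer_regular n" for k
          using 3(1) e_pos[of k] mult_strict_mono[of "e k" 1 "e k" 1]
          by (intro regularI[where s = "e k * e k"]) (simp_all add: b_def m algebra_simps)
        show "(\<lambda>k. (of_real (e k), m + of_real (e k))) \<longlonglongrightarrow> (\<beta>, m)"
          using 3(1) by (auto intro!: tendsto_eq_intros e_lim)
      qed
    qed
  qed
  thus ?thesis using assms unfolding islimpt_sequential by (metis DiffI singletonD)
qed

text \<open>Outside the regular set the polynomial form, being continuous in (\<beta>, m) and equal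
  to the raw expression on the regular set, supplies the limit.\<close>

lemma kummer_coeff_eq_poly: "kummer_coeff \<beta> m z n = kummer_poly \<beta> m z n"
proof (cases "(\<beta>, m) \<in> kummer_regular n")
  case True
  thus ?thesis by (simp add: kummer_coeff_def kummer_coeff_raw_eq_poly)
next
  case False
  define P where "P = (\<lambda>p. kummer_poly (fst p) (snd p) z n)"
  have "(P \<longlongrightarrow> P (\<beta>, m)) (at (\<beta>, m) within kummer_regular n)"
    \<comment> \<open>Writing the binomial coefficient as a finite product lets the continuity rules
      apply in its upper argument.\<close>
    unfolding P_def kummer_poly_def gbinomial_prod_rev
    by (intro tendsto_intros) auto
  moreover have "eventually (\<lambda>p. P p = (\<lambda>(\<beta>', m'). kummer_coeff_raw \<beta>' m' z n) p)
      (at (\<beta>, m) within kummer_regular n)"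
    by (auto simp: eventually_at_filter P_def kummer_coeff_raw_eq_poly intro!: always_eventually)
  ultimately have "((\<lambda>(\<beta>', m'). kummer_coeff_raw \<beta>' m' z n) \<longlongrightarrow> P (\<beta>, m))
      (at (\<beta>, m) within kummer_regular n)"
    by (rule Lim_transform_eventually)
  thus ?thesis
    using False islimpt_kummer_regular[OF False]
    by (simp add: kummer_coeff_def tendsto_Lim trivial_limit_within P_def)
qed

section \<open>The identity for small x\<close>

text \<open>A holomorphic logarithm near 0 of \<phi>(w) = (1 + w)^\<beta> exp(w z), so that \<phi>^m
  can be written as \<open>exp (m * kummer_exponent \<beta> z w)\<close> without choosing a branch
  again.\<close>

definition kummer_exponent :: "complex \<Rightarrow> complex \<Rightarrow> complex \<Rightarrow> complex" where
  "kummer_exponent \<beta> z w = \<beta> * Ln (1 + w) + w * z"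

text \<open>Near 0 the function is the product of an exponential and a binomial power, and the
  Cauchy product of their expansions has exactly \<open>kummer_poly\<close> as its n-th
  coefficient.\<close>

lemma kummer_poly_eq_deriv:
  "kummer_poly \<beta> m z n = (deriv ^^ n)
     (\<lambda>w. exp (m * kummer_exponent \<beta> z w) * exp (kummer_exponent \<beta> z w) ^ n) 0 / fact n"
proof -
  define F where "F = fps_exp ((m + of_nat n) * z) * fps_binomial ((m + of_nat n) * \<beta>)"
  define f where "f = (\<lambda>w. exp ((m + of_nat n) * z * w) * (1 + w) powr ((m + of_nat n) * \<beta>))"
  have "f has_fps_expansion F"
    unfolding f_def F_def
    by (intro has_fps_expansion_mult has_fps_expansion_exp has_fps_expansion_binomial_complex)
  hence "fps_nth F n = (deriv ^^ n) f 0 / fact n"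
    by (rule fps_nth_fps_expansion)
  also have "(deriv ^^ n) f 0 = (deriv ^^ n)
      (\<lambda>w. exp (m * kummer_exponent \<beta> z w) * exp (kummer_exponent \<beta> z w) ^ n) 0"
  proof (rule higher_deriv_cong_ev)
    have "eventually (\<lambda>w::complex. w \<in> ball 0 1) (nhds 0)"
      by (intro eventually_nhds_in_open) auto
    thus "eventually (\<lambda>w. f w = exp (m * kummer_exponent \<beta> z w) * exp (kummer_exponent \<beta> z w) ^ n) (nhds 0)"
    proof eventually_elim
      case (elim w)
      hence "1 + w \<noteq> 0" by (auto simp: add_eq_0_iff)
      thus ?case
        by (simp add: f_def powr_def kummer_exponent_def algebra_simps flip: exp_add exp_of_nat_mult)
    qed
  qed simp
  also have "fps_nth F n = kummer_poly \<beta> m z n"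
    unfolding F_def fps_mult_nth kummer_poly_def atLeast0AtMost
    by (intro sum.cong) (auto simp: mult_ac)
  finally show ?thesis .
qed

lemma one_plus_notin_nonpos_Reals:
  assumes "norm (w :: complex) < 1"
  shows "1 + w \<notin> \<real>\<^sub>\<le>\<^sub>0"
proof
  assume "1 + w \<in> \<real>\<^sub>\<le>\<^sub>0"
  hence "Re w \<le> - 1" by (simp add: complex_nonpos_Reals_iff)
  thus False using assms abs_Re_le_cmod[of w] by linarith
qed

text \<open>Lagrange inversion is applied to \<phi> = exp E and h = exp (m E), with E the exponent.
  What remains is to match the principal powers with these exponentials and to compute t \<phi>'(x)
  = x (\<beta> / (1 + x) + z).\<close>

lemma kummer_term_sums_near_0:
  "eventually (\<lambda>x. kummer_term \<beta> m x z sums kummer_sum_value \<beta> m x z) (nhds 0)"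
proof -
  let ?E = "kummer_exponent \<beta> z"
  have holE: "?E holomorphic_on ball 0 1"
    unfolding kummer_exponent_def
    by (intro holomorphic_intros) (auto simp: one_plus_notin_nonpos_Reals)
  have "eventually (\<lambda>x. (\<lambda>n. (deriv ^^ n) (\<lambda>w. exp (m * ?E w) * exp (?E w) ^ n) 0 / fact n * (x / exp (?E x)) ^ n)
           sums (exp (m * ?E x) / (1 - x / exp (?E x) * deriv (\<lambda>w. exp (?E w)) x))) (nhds 0)"
    by (rule Lagrange_inversion_sums[of 1]) (auto intro!: holomorphic_intros holE)
  moreover have "eventually (\<lambda>x::complex. x \<in> ball 0 1) (nhds 0)"
    by (intro eventually_nhds_in_open) auto
  \<comment> \<open>The exponent vanishes at 0, so this bounds its imaginary part by pi; then
    \<open>Ln\<close> inverts \<open>exp\<close> and the principal m-th power is the intended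
    branch.\<close>
  moreover have "eventually (\<lambda>x. dist (?E x) (?E 0) < pi) (nhds 0)"
  proof (rule tendstoD)
    have "isCont ?E 0"
      using holE by (meson centre_in_ball continuous_on_eq_continuous_at holomorphic_on_imp_continuous_on
          open_ball zero_less_one)
    thus "(?E \<longlongrightarrow> ?E 0) (nhds 0)"
      by (simp add: isCont_def tendsto_at_iff_tendsto_nhds)
  qed simp
  ultimately show ?thesis
  proof eventually_elim
    case (elim x)
    have x: "1 + x \<notin> \<real>\<^sub>\<le>\<^sub>0" "1 + x \<noteq> 0"
      using one_plus_notin_nonpos_Reals[of x] elim(2) by auto
    have E: "(x + 1) powr \<beta> * exp (x * z) = exp (?E x)"
      using x by (simp add: powr_def kummer_exponent_def add.commute exp_add)
    have t: "x * (x + 1) powr (- \<beta>) * exp (- (x * z)) = x / exp (?E x)"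
      by (simp add: powr_minus exp_minus field_simps flip: E)
    have "\<bar>Im (?E x)\<bar> < pi"
      using elim(3) abs_Im_le_cmod[of "?E x"] by (simp add: kummer_exponent_def)
    hence "Ln (exp (?E x)) = ?E x" by (intro Ln_exp) auto
    hence h: "exp (?E x) powr m = exp (m * ?E x)" by (simp add: powr_def)
    have "((\<lambda>w. exp (?E w)) has_field_derivative exp (?E x) * (\<beta> / (1 + x) + z)) (at x)"
      unfolding kummer_exponent_def using x
      by (auto intro!: derivative_eq_intros simp: field_simps)
    hence "x / exp (?E x) * deriv (\<lambda>w. exp (?E w)) x = x * (\<beta> / (1 + x) + z)"
      by (simp add: DERIV_imp_deriv)
    moreover have "1 - x * (\<beta> / (1 + x) + z) = - (x * (\<beta> + x * z + z - 1) - 1) / (1 + x)"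
      using x by (simp add: field_simps)
    ultimately have "exp (m * ?E x) / (1 - x / exp (?E x) * deriv (\<lambda>w. exp (?E w)) x) =
        kummer_sum_value \<beta> m x z"
      by (simp only: kummer_sum_value_def E h) (simp add: minus_divide_right mult_ac add_ac)
    thus ?case
      using elim(1) by (simp add: kummer_term_def[abs_def] kummer_coeff_eq_poly kummer_poly_eq_deriv t)
  qed
qed

section \<open>Analytic continuation to larger domains\<close>

text \<open>The terms depend on x only through t, which need not be injective, so convergence at x
  alone does not fix the value. The second part therefore asks for a connection to 0 inside the set
  where the series converges and the branches are holomorphic.\<close>

theorem proposition3p16:
  fixes \<beta> m z :: complex
  shows "(\<exists>r>0. \<forall>x. norm x < r \<longrightarrow> kummer_term \<beta> m x z sums kummer_sum_value \<beta> m x z) \<and>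
         (\<forall>U. open U \<and> connected U \<and> 0 \<in> U \<and> U \<subseteq> principal_domain \<beta> z \<and>
              (\<forall>x\<in>U. summable (kummer_term \<beta> m x z)) \<longrightarrow>
              (\<forall>x\<in>U. kummer_term \<beta> m x z sums kummer_sum_value \<beta> m x z))"
proof -
  obtain r where r: "r > 0" "\<And>x. norm x < r \<Longrightarrow> kummer_term \<beta> m x z sums kummer_sum_value \<beta> m x z"
    using kummer_term_sums_near_0[of \<beta> m z] by (auto simp: eventually_nhds_metric)
  have continued: "kummer_term \<beta> m x z sums kummer_sum_value \<beta> m x z"
    if U: "open U" "connected U" "0 \<in> U" "U \<subseteq> principal_domain \<beta> z"
      and summ: "\<And>x. x \<in> U \<Longrightarrow> summable (kummer_term \<beta> m x z)" and x: "x \<in> U" for U x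
  proof -
    define t where "t = (\<lambda>x. x * (x + 1) powr (- \<beta>) * exp (- (x * z)))"
    define a where "a = kummer_coeff \<beta> m z"
    define F where "F = (\<lambda>s. \<Sum>n. a n * s ^ n)"
    define N where "N = (\<lambda>x. (x + 1) * ((x + 1) powr \<beta> * exp (x * z)) powr m)"
    define D where "D = (\<lambda>x. x * (\<beta> + x * z + z - 1) - 1)"
    have term_eq: "kummer_term \<beta> m y z = (\<lambda>n. a n * t y ^ n)" for y
      by (simp add: kummer_term_def[abs_def] a_def t_def)
    have value_eq: "kummer_sum_value \<beta> m y z = - N y / D y" for y
      by (simp add: kummer_sum_value_def N_def D_def)
    have dom: "y + 1 \<notin> \<real>\<^sub>\<le>\<^sub>0" "(y + 1) powr \<beta> * exp (y * z) \<notin> \<real>\<^sub>\<le>\<^sub>0" if "y \<in> U" for y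
      using U(4) that by (auto simp: principal_domain_def)
    have ne: "y + 1 \<noteq> 0" if "y \<in> U" for y using dom(1)[OF that] by auto
    have N_ne: "N y \<noteq> 0" if "y \<in> U" for y
      using ne[OF that] by (simp add: N_def)
    have t_hol: "t holomorphic_on U"
      unfolding t_def by (intro holomorphic_intros dom)
    have N_hol: "N holomorphic_on U"
      unfolding N_def by (intro holomorphic_intros dom)
    have "\<not> t constant_on U"
    proof
      assume "t constant_on U"
      hence "t y = t 0" if "y \<in> U" for y using that U(3) by (auto simp: constant_on_def)
      hence "U \<subseteq> {0}" using ne by (fastforce simp: t_def)
      hence "U = {0}" using U(3) by auto
      thus False using U(1) not_open_singleton by metis
    qed
    hence t_open: "open (t ` U)"
      using open_mapping_thm[OF t_hol U(1,2) U(1)] by simp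
    \<comment> \<open>Summability at y alone gives only a weak inequality. Openness of the image of
      t provides a point of larger modulus at which the series still converges.\<close>
    have conv: "ereal (norm (t y)) < conv_radius a" if y: "y \<in> U" for y
    proof -
      obtain e where e: "e > 0" "ball (t y) e \<subseteq> t ` U"
        using t_open y by (meson imageI open_contains_ball)
      \<comment> \<open>A step of length e/2 radially outward from \<open>t y\<close>; since
        \<open>sgn 0 = 0\<close>, the origin needs its own direction.\<close>
      define s where "s = t y + (if t y = 0 then of_real (e / 2) else of_real (e / 2) * sgn (t y))"
      have "s \<in> ball (t y) e"
        using e(1) by (simp add: s_def dist_norm norm_mult norm_sgn)
      then obtain y' where y': "y' \<in> U" "s = t y'" using e(2) by auto
      have "norm (t y) < norm s"
      proof (cases "t y = 0")
        case False
        hence "s = of_real (norm (t y) + e / 2) * sgn (t y)"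
          by (simp add: s_def algebra_simps sgn_eq)
        hence "norm s = \<bar>norm (t y) + e / 2\<bar>"
          using False by (simp only: norm_mult norm_sgn norm_of_real) simp
        thus ?thesis using e(1) by simp
      qed (use e(1) in \<open>simp add: s_def\<close>)
      also have "ereal (norm s) \<le> conv_radius a"
        using summ[OF y'(1)] by (intro conv_radius_geI) (simp add: term_eq y'(2))
      finally show ?thesis by simp
    qed
    have F_hol: "(F \<circ> t) holomorphic_on U"
    proof (rule holomorphic_on_compose[OF t_hol])
      have "F field_differentiable (at s)" if s: "ereal (norm s) < conv_radius a" for s
      proof -
        obtain R where R: "ereal (norm s) < ereal R" "ereal R < conv_radius a"
          using ereal_dense2[OF s] by blast
        have "0 < R" using R(1) le_less_trans[OF norm_ge_zero, of s R] by simp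
        hence "summable (\<lambda>n. a n * of_real R ^ n)"
          using R(2) by (intro summable_in_conv_radius) simp
        hence "(F has_field_derivative (\<Sum>n. diffs a n * s ^ n)) (at s)"
          unfolding F_def using R(1) \<open>0 < R\<close> by (intro termdiffs_strong[where K = "of_real R"]) auto
        thus ?thesis by (auto simp: field_differentiable_def)
      qed
      thus "F holomorphic_on t ` U"
        using conv by (auto simp: holomorphic_on_def intro: field_differentiable_at_within)
    qed
    \<comment> \<open>Both sides are holomorphic on all of U even where \<open>D\<close> vanishes.
      The starting set omits zeros of \<open>D\<close>, where HOL's division by zero would make the
      local formula uninformative; it contains 0 because \<open>D 0 = -1\<close>.\<close>
    have eq: "F (t y) * D y = - N y" if "y \<in> U" for y
    proof (rule analytic_continuation_open[where s = "{y \<in> U \<inter> ball 0 r. D y \<noteq> 0}" and s' = U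
          and f = "\<lambda>y. F (t y) * D y" and g = "\<lambda>y. - N y"])
      have "continuous_on (U \<inter> ball 0 r) D"
        unfolding D_def by (intro continuous_intros)
      hence "openin (top_of_set (U \<inter> ball 0 r)) ((U \<inter> ball 0 r) \<inter> D -` (- {0}))"
        by (rule continuous_openin_preimage_gen) auto
      hence "open ((U \<inter> ball 0 r) \<inter> D -` (- {0}))"
        using U(1) openin_open_trans by blast
      also have "(U \<inter> ball 0 r) \<inter> D -` (- {0}) = {y \<in> U \<inter> ball 0 r. D y \<noteq> 0}"
        by auto
      finally show "open {y \<in> U \<inter> ball 0 r. D y \<noteq> 0}" .
      have "0 \<in> {y \<in> U \<inter> ball 0 r. D y \<noteq> 0}" using U(3) r(1) by (simp add: D_def)
      thus "{y \<in> U \<inter> ball 0 r. D y \<noteq> 0} \<noteq> {}" by blast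
      show "(\<lambda>y. F (t y) * D y) holomorphic_on U" "(\<lambda>y. - N y) holomorphic_on U"
        using F_hol N_hol unfolding D_def o_def by (auto intro!: holomorphic_intros)
      fix w assume w: "w \<in> {y \<in> U \<inter> ball 0 r. D y \<noteq> 0}"
      hence "F (t w) = - N w / D w"
        using r(2)[of w] by (simp add: term_eq F_def sums_iff value_eq)
      thus "F (t w) * D w = - N w" using w by simp
    qed (use U that in auto)
    have "D x \<noteq> 0" using eq[OF x] N_ne[OF x] by auto
    hence "F (t x) = kummer_sum_value \<beta> m x z"
      using eq[OF x] by (metis value_eq nonzero_eq_divide_eq)
    thus ?thesis
      using summ[OF x] by (auto simp: term_eq F_def sums_iff)
  qed
  show ?thesis
  proof (intro conjI allI impI ballI)
    show "\<exists>r>0. \<forall>x. norm x < r \<longrightarrow> kummer_term \<beta> m x z sums kummer_sum_value \<beta> m x z"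
      using r by (intro exI[of _ r]) simp
  next
    fix U x
    assume "open U \<and> connected U \<and> 0 \<in> U \<and> U \<subseteq> principal_domain \<beta> z \<and>
      (\<forall>x\<in>U. summable (kummer_term \<beta> m x z))" "x \<in> U"
    thus "kummer_term \<beta> m x z sums kummer_sum_value \<beta> m x z"
      by (intro continued[of U x]) simp_all
  qed
qed

end
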